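(* Let $C_2=\sup_{\mathcal P}\lambda(\mathcal P)$, where the supremum is over all pairs of pairs $\mathcal P=((x_1,y_1),(x_2,y_2))$ of points of $\mathbb{R}^2$ such that the four points $x_1,y_1,x_2,y_2$ are distinct and $|x_i-y_i|\le 1$ for $i=1,2$, and where $$\lambda(\mathcal P)=\inf_{\gamma_1,\gamma_2}\max\{\operatorname{len}(\gamma_1),\operatorname{len}(\gamma_2)\},$$ the infimum being over all pairs of rectifiable simple arcs $\gamma_1,\gamma_2$ in $\mathbb{R}^2$ such that $\gamma_i$ joins $x_i$ to $y_i$ for $i=1,2$ and $\gamma_1\cap\gamma_2=\varnothing$. Then $$C_2=\sqrt2.$$
   Context: $|\cdot|$ is the Euclidean norm on $\mathbb{R}^2$. A simple arc from $x$ to $y$ is the image of an injective continuous map $[0,1]\to\mathbb{R}^2$ sending $0$ to $x$ and $1$ to $y$; it is rectifiable if it has finite length, and $\operatorname{len}(\gamma)$ denotes the length of a rectifiable arc $\gamma$. Arcs include their endpoints, so disjointness of $\gamma_1$ and $\gamma_2$ means that the two closed arcs have no point in common. *)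

theory Defs
  imports "HOL-Analysis.Analysis"
begin

definition path_length :: "(real \<Rightarrow> 'a::metric_space) \<Rightarrow> ereal" where
  "path_length g =
     (SUP ts \<in> {ts. sorted ts \<and> set ts \<subseteq> {0..1}}.
        ereal (\<Sum>i < length ts - 1. dist (g (ts ! i)) (g (ts ! Suc i))))"

definition rectifiable :: "(real \<Rightarrow> 'a::metric_space) \<Rightarrow> bool" where
  "rectifiable g \<longleftrightarrow> path_length g < \<infinity>"

(* Arcs are handled through injective parametrizations on [0,1]. The next two lemmas show that
   the length depends only on the image, so it is the length of the arc as a point set. *)

lemma path_length_le_of_arcs:
  fixes g h :: "real \<Rightarrow> 'a::metric_space"
  assumes g: "arc g" and h: "arc h" and im: "path_image g = path_image h"
  shows "path_length g \<le> path_length h"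
proof -
  obtain k where hk: "homeomorphism {0..1} (path_image h) h k"
    using homeomorphism_arc[OF h] by blast
  define p where "p = k \<circ> g"
  have gp: "h (p t) = g t" and p01: "p t \<in> {0..1}" if "t \<in> {0..1}" for t
  proof -
    have "g t \<in> path_image h" using that im by (auto simp: path_image_def)
    then show "h (p t) = g t" "p t \<in> {0..1}"
      using hk unfolding homeomorphism_def p_def by auto
  qed
  have "continuous_on {0..1} p"
    unfolding p_def using g hk im
    by (intro continuous_on_compose) (auto simp: arc_def path_def path_image_def homeomorphism_def)
  moreover have "inj_on p {0..1}"
  proof (rule inj_onI)
    fix s t :: real assume "s \<in> {0..1}" "t \<in> {0..1}" "p s = p t"
    then show "s = t" using g gp[of s] gp[of t] by (auto simp: arc_def inj_on_def)
  qed
  ultimately have mono: "mono_on {0..1} p \<or> antimono_on {0..1} p"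
    using injective_eq_monotone_map[OF is_interval_cc] strict_mono_iff_mono[of "{0..1}" p]
      strict_antimono_iff_antimono[of "{0..1}" p] by blast
  show ?thesis
    unfolding path_length_def
  proof (rule SUP_least)
    fix ts :: "real list"
    assume "ts \<in> {ts. sorted ts \<and> set ts \<subseteq> {0..1}}"
    then have ts: "sorted ts" "set ts \<subseteq> {0..1}" by auto
    define n where "n = length ts - 1"
    have nth: "ts ! i \<in> {0..1}" if "i < length ts" for i using ts(2) that nth_mem by blast
    have hp: "h (p (ts ! i)) = g (ts ! i)" if "i < length ts" for i using gp nth that by blast
    have eq: "(\<Sum>i<n. dist (g (ts ! i)) (g (ts ! Suc i)))
        = (\<Sum>i<n. dist (h (map p ts ! i)) (h (map p ts ! Suc i)))"
      by (intro sum.cong) (auto simp: n_def hp)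
    have sub: "set (map p ts) \<subseteq> {0..1}" using ts(2) p01 by auto
    have "\<exists>us. sorted us \<and> set us \<subseteq> {0..1} \<and>
        (\<Sum>i<n. dist (h (map p ts ! i)) (h (map p ts ! Suc i)))
        = (\<Sum>i<length us - 1. dist (h (us ! i)) (h (us ! Suc i)))"
      using mono
    proof
      assume m: "mono_on {0..1} p"
      have "map p ts ! i \<le> map p ts ! j" if "i \<le> j" "j < length (map p ts)" for i j
        using mono_onD[OF m, of "ts ! i" "ts ! j"] sorted_nth_mono[OF ts(1), of i j] nth[of i] nth[of j] that
        by simp
      then have "sorted (map p ts)" by (simp add: sorted_iff_nth_mono)
      then show ?thesis using sub by (intro exI[of _ "map p ts"]) (simp add: n_def)
    next
      assume m: "antimono_on {0..1} p"
      have "map p ts ! j \<le> map p ts ! i" if "i \<le> j" "j < length (map p ts)" for i j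
        using monotone_onD[OF m, of "ts ! i" "ts ! j"] sorted_nth_mono[OF ts(1), of i j] nth[of i] nth[of j] that
        by simp
      then have "sorted (rev (map p ts))" by (simp add: sorted_rev_iff_nth_mono)
      moreover have "(\<Sum>i<n. dist (h (map p ts ! i)) (h (map p ts ! Suc i)))
        = (\<Sum>i<n. dist (h (rev (map p ts) ! i)) (h (rev (map p ts) ! Suc i)))"
      proof -
        have "dist (h (map p ts ! (n - Suc i))) (h (map p ts ! Suc (n - Suc i)))
            = dist (h (rev (map p ts) ! i)) (h (rev (map p ts) ! Suc i))" if "i < n" for i
        proof -
          have i: "Suc i < length (map p ts)" using that by (simp add: n_def)
          have "length (map p ts) - Suc i = Suc (n - Suc i)" "length (map p ts) - Suc (Suc i) = n - Suc i"
            using that by (simp_all add: n_def)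
          then have 1: "rev (map p ts) ! i = map p ts ! Suc (n - Suc i)"
            and 2: "rev (map p ts) ! Suc i = map p ts ! (n - Suc i)"
            using rev_nth[of i "map p ts"] rev_nth[of "Suc i" "map p ts"] i by simp_all
          show ?thesis unfolding 1 2 by (rule dist_commute)
        qed
        then have "(\<Sum>i<n. dist (h (map p ts ! (n - Suc i))) (h (map p ts ! Suc (n - Suc i))))
            = (\<Sum>i<n. dist (h (rev (map p ts) ! i)) (h (rev (map p ts) ! Suc i)))"
          by (intro sum.cong) simp_all
        then show ?thesis
          using sum.nat_diff_reindex[of "\<lambda>i. dist (h (map p ts ! i)) (h (map p ts ! Suc i))" n]
          by (simp only:)
      qed
      ultimately show ?thesis using sub by (intro exI[of _ "rev (map p ts)"]) (simp add: n_def)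
    qed
    then obtain us where us: "sorted us" "set us \<subseteq> {0..1}"
        "(\<Sum>i<n. dist (h (map p ts ! i)) (h (map p ts ! Suc i)))
        = (\<Sum>i<length us - 1. dist (h (us ! i)) (h (us ! Suc i)))"
      by blast
    show "ereal (\<Sum>i<length ts - 1. dist (g (ts ! i)) (g (ts ! Suc i)))
      \<le> (SUP ts \<in> {ts. sorted ts \<and> set ts \<subseteq> {0..1}}.
          ereal (\<Sum>i<length ts - 1. dist (h (ts ! i)) (h (ts ! Suc i))))"
      using us eq unfolding n_def by (intro SUP_upper2[of us]) auto
  qed
qed

lemma path_length_eq_of_arcs:
  assumes "arc g" "arc h" "path_image g = path_image h"
  shows "path_length g = path_length h"
  by (intro antisym path_length_le_of_arcs assms assms(3)[symmetric])

definition rectifiable_arcs :: "'a::metric_space \<Rightarrow> 'a \<Rightarrow> (real \<Rightarrow> 'a) set" where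
  "rectifiable_arcs x y = {g. arc g \<and> rectifiable g \<and> pathstart g = x \<and> pathfinish g = y}"

definition admissible_pairs :: "(((real^2) \<times> (real^2)) \<times> ((real^2) \<times> (real^2))) set" where
  "admissible_pairs =
     {((x1, y1), (x2, y2)). distinct [x1, y1, x2, y2] \<and> norm (x1 - y1) \<le> 1 \<and> norm (x2 - y2) \<le> 1}"

(* Infimum and supremum are taken in the complete lattice of extended reals: the infimum over an
   empty family and the supremum of an unbounded family are infinite. *)

definition lam :: "((real^2) \<times> (real^2)) \<times> ((real^2) \<times> (real^2)) \<Rightarrow> ereal" where
  "lam = (\<lambda>((x1, y1), (x2, y2)).
     INF (g1, g2) \<in> {(g1, g2). g1 \<in> rectifiable_arcs x1 y1 \<and> g2 \<in> rectifiable_arcs x2 y2 \<and>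
                         path_image g1 \<inter> path_image g2 = {}}.
       max (path_length g1) (path_length g2))"

definition C2 :: ereal where
  "C2 = (SUP P \<in> admissible_pairs. lam P)"

end

theory Submission
  imports Defs
begin

text \<open>
  Upper bound: if the two segments cross, let \<open>w\<close> be the vector joining their midpoints and \<open>D1\<close>,
  \<open>D2\<close> the segment vectors. Whichever of \<open>w \<bullet> D1\<close>, \<open>w \<bullet> D2\<close> is larger in absolute
  value tells which of the four endpoints to walk around: if \<open>w \<bullet> D2 \<ge> \<bar>w \<bullet> D1\<bar>\<close>, then the
  squared distances from \<open>x2\<close> to \<open>x1\<close> and \<open>y1\<close> add up to at most \<open>(|D1|\<^sup>2 + |D2|\<^sup>2) / 2 \<le> 1\<close>,
  so the detour of the first arc around \<open>x2\<close> has length at most \<open>\<surd>2\<close> up to \<open>\<epsilon>\<close>. If an endpoint lies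
  on the line through the other pair, the arcs can be bent slightly to opposite sides of that line.

  Lower bound: take the diagonals of a square, of length 1. An arc of length less than \<open>\<surd>2\<close> joining
  the ends of one diagonal stays strictly inside the strip parallel to it through the ends of the other,
  so prolonging both arcs by rays creates no new intersections, and the prolonged arcs must cross.
\<close>

section \<open>Length of polygonal paths\<close>

text \<open>Chord sums are dominated by increments of \<open>F\<close>, which telescope. With
  \<open>F\<close> the length travelled so far, this bounds the length of an explicit polygonal
  path.\<close>

lemma path_length_le_potential:
  fixes F :: "real \<Rightarrow> real"
  assumes "\<And>s t. 0 \<le> s \<Longrightarrow> s \<le> t \<Longrightarrow> t \<le> 1 \<Longrightarrow> dist (g s) (g t) \<le> F t - F s"
  shows "path_length g \<le> ereal (F 1 - F 0)"
  unfolding path_length_def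
proof (rule SUP_least)
  fix ts :: "real list"
  assume "ts \<in> {ts. sorted ts \<and> set ts \<subseteq> {0..1}}"
  then have ts: "sorted ts" "set ts \<subseteq> {0..1}" by auto
  have mono: "F s \<le> F t" if "0 \<le> s" "s \<le> t" "t \<le> 1" for s t
    using assms[OF that] zero_le_dist[of "g s" "g t"] by linarith
  have nth: "0 \<le> ts ! i" "ts ! i \<le> 1" if "i < length ts" for i
    using subsetD[OF ts(2) nth_mem[OF that]] by simp_all
  have "(\<Sum>i < length ts - 1. dist (g (ts ! i)) (g (ts ! Suc i)))
      \<le> (\<Sum>i < length ts - 1. F (ts ! Suc i) - F (ts ! i))"
  proof (rule sum_mono)
    fix i assume "i \<in> {..<length ts - 1}"
    then have i: "Suc i < length ts" by simp
    then have "ts ! i \<le> ts ! Suc i" using ts(1) by (simp add: sorted_iff_nth_mono)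
    then show "dist (g (ts ! i)) (g (ts ! Suc i)) \<le> F (ts ! Suc i) - F (ts ! i)"
      using assms[of "ts ! i" "ts ! Suc i"] nth[of i] nth[of "Suc i"] i by simp
  qed
  also have "\<dots> = F (ts ! (length ts - 1)) - F (ts ! 0)"
    by (rule sum_lessThan_telescope[of "\<lambda>i. F (ts ! i)"])
  also have "\<dots> \<le> F 1 - F 0"
  proof (cases "ts = []")
    case True
    then show ?thesis using mono[of 0 1] by simp
  next
    case False
    then have "F (ts ! (length ts - 1)) \<le> F 1" "F 0 \<le> F (ts ! 0)"
      using nth[of 0] nth[of "length ts - 1"] by (auto intro!: mono)
    then show ?thesis by linarith
  qed
  finally show "ereal (\<Sum>i < length ts - 1. dist (g (ts ! i)) (g (ts ! Suc i))) \<le> ereal (F 1 - F 0)"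
    by simp
qed

text \<open>The partition \<open>[0, t, 1]\<close> through \<open>p\<close> suffices. An arc of
  bounded length is thereby confined to an ellipse whose foci are its endpoints.\<close>

lemma path_length_ge_dist_via:
  assumes "p \<in> path_image g"
  shows "ereal (dist (pathstart g) p + dist p (pathfinish g)) \<le> path_length g"
proof -
  obtain t where t: "t \<in> {0..1}" "p = g t" using assms by (auto simp: path_image_def)
  show ?thesis
    unfolding path_length_def using t
    by (intro SUP_upper2[of "[0, t, 1]"])
      (auto simp: pathstart_def pathfinish_def lessThan_Suc numeral_2_eq_2)
qed

lemma path_length_linepath_le: "path_length (linepath x y) \<le> ereal (dist x y)"
proof -
  have "dist (linepath x y s) (linepath x y t) \<le> dist x y * t - dist x y * s"
    if "0 \<le> s" "s \<le> t" "t \<le> 1" for s t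
  proof -
    have "linepath x y s - linepath x y t = (t - s) *\<^sub>R (x - y)"
      by (simp add: linepath_def algebra_simps)
    then have "dist (linepath x y s) (linepath x y t) = (t - s) * dist x y"
      using that by (simp add: dist_norm)
    then show ?thesis by (simp add: algebra_simps)
  qed
  from path_length_le_potential[of _ "\<lambda>t. dist x y * t", OF this] show ?thesis by simp
qed

lemma path_length_join_linepath_le:
  "path_length (linepath x z +++ linepath z y) \<le> ereal (dist x z + dist z y)"
proof -
  \<comment> \<open>\<open>+++\<close> runs each leg at double speed on half of the interval. The
    clamped terms are the parameters of the two legs, so \<open>F\<close> is the length covered by
    time \<open>t\<close>, without case distinction.\<close>
  define F :: "real \<Rightarrow> real"
    where "F t = dist x z * min (2 * t) 1 + dist z y * max (2 * t - 1) 0" for t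
  have rep: "(linepath x z +++ linepath z y) t
      = x + min (2 * t) 1 *\<^sub>R (z - x) + max (2 * t - 1) 0 *\<^sub>R (y - z)" for t
    by (auto simp: joinpaths_def linepath_def min_def max_def algebra_simps)
  have "dist ((linepath x z +++ linepath z y) s) ((linepath x z +++ linepath z y) t) \<le> F t - F s"
    if "0 \<le> s" "s \<le> t" "t \<le> 1" for s t
  proof -
    define a where "a = min (2 * t) 1 - min (2 * s) 1"
    define b where "b = max (2 * t - 1) 0 - max (2 * s - 1) 0"
    have ab: "a \<ge> 0" "b \<ge> 0" using that by (auto simp: a_def b_def)
    have "(linepath x z +++ linepath z y) s - (linepath x z +++ linepath z y) t
        = a *\<^sub>R (x - z) + b *\<^sub>R (z - y)"
      unfolding rep a_def b_def by (simp add: algebra_simps)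
    then have "dist ((linepath x z +++ linepath z y) s) ((linepath x z +++ linepath z y) t)
        \<le> a * dist x z + b * dist z y"
      using norm_triangle_ineq[of "a *\<^sub>R (x - z)" "b *\<^sub>R (z - y)"] ab by (simp add: dist_norm)
    also have "\<dots> = F t - F s" by (simp add: F_def a_def b_def algebra_simps)
    finally show ?thesis .
  qed
  from path_length_le_potential[of _ F, OF this] show ?thesis by (simp add: F_def)
qed

text \<open>The functional \<open>n\<close> stays at most \<open>n \<bullet> z\<close> on the first
  leg and at least \<open>n \<bullet> z\<close> on the second, with equality only at
  \<open>z\<close>, so the legs share no other point.\<close>

lemma arc_join_linepath:
  fixes x y z :: "'a::euclidean_space"
  assumes "n \<bullet> x < n \<bullet> z" "n \<bullet> z < n \<bullet> y"
  shows "arc (linepath x z +++ linepath z y)"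
proof (rule arc_join)
  show "arc (linepath x z)" "arc (linepath z y)"
    using assms by (auto intro!: arc_linepath)
  show "path_image (linepath x z) \<inter> path_image (linepath z y) \<subseteq> {pathstart (linepath z y)}"
  proof
    fix p assume p: "p \<in> path_image (linepath x z) \<inter> path_image (linepath z y)"
    obtain u where u: "0 \<le> u" "u \<le> 1" "p = (1 - u) *\<^sub>R x + u *\<^sub>R z"
      using p by (auto simp: in_segment)
    obtain v where v: "0 \<le> v" "v \<le> 1" "p = (1 - v) *\<^sub>R z + v *\<^sub>R y"
      using p by (auto simp: in_segment)
    have "n \<bullet> p = n \<bullet> z - (1 - u) * (n \<bullet> z - n \<bullet> x)"
      unfolding u(3) by (simp add: algebra_simps)
    moreover have "n \<bullet> p = n \<bullet> z + v * (n \<bullet> y - n \<bullet> z)"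
      unfolding v(3) by (simp add: algebra_simps)
    moreover have "(1 - u) * (n \<bullet> z - n \<bullet> x) \<ge> 0" "v * (n \<bullet> y - n \<bullet> z) \<ge> 0"
      using u v assms by simp_all
    ultimately have "v * (n \<bullet> y - n \<bullet> z) = 0" by linarith
    then have "v = 0" using assms by simp
    then show "p \<in> {pathstart (linepath z y)}" using v by simp
  qed
qed simp

section \<open>Pairs joinable by short disjoint arcs\<close>

definition disjointly_joinable :: "real \<Rightarrow> 'a::metric_space \<Rightarrow> 'a \<Rightarrow> 'a \<Rightarrow> 'a \<Rightarrow> bool" where
  "disjointly_joinable L x1 y1 x2 y2 \<longleftrightarrow>
     (\<exists>g1 g2. arc g1 \<and> pathstart g1 = x1 \<and> pathfinish g1 = y1 \<and> path_length g1 \<le> ereal L \<and>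
        arc g2 \<and> pathstart g2 = x2 \<and> pathfinish g2 = y2 \<and> path_length g2 \<le> ereal L \<and>
        path_image g1 \<inter> path_image g2 = {})"

lemma disjointly_joinable_swap:
  fixes x1 :: "'a::metric_space"
  shows "disjointly_joinable L x1 y1 x2 y2 \<longleftrightarrow> disjointly_joinable L x2 y2 x1 y1"
proof -
  have "disjointly_joinable L c d a b" if j: "disjointly_joinable L a b c d" for a b c d :: 'a
  proof -
    obtain g1 g2 where g: "arc g1" "pathstart g1 = a" "pathfinish g1 = b" "path_length g1 \<le> ereal L"
      "arc g2" "pathstart g2 = c" "pathfinish g2 = d" "path_length g2 \<le> ereal L"
      "path_image g1 \<inter> path_image g2 = {}"
      using j unfolding disjointly_joinable_def by blast
    then show ?thesis
      unfolding disjointly_joinable_def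
      by (intro exI[of _ g2] exI[of _ g1] conjI) (simp_all add: Int_commute)
  qed
  then show ?thesis by blast
qed

text \<open>Reversal keeps the image, hence the length. Together with
  \<open>disjointly_joinable_swap\<close> this gives all relabellings of the endpoints, so the
  geometric lemmas can fix one labelling.\<close>

lemma disjointly_joinable_flip:
  assumes "disjointly_joinable L x1 y1 x2 y2"
  shows "disjointly_joinable L x1 y1 y2 x2"
proof -
  obtain g1 g2 where g: "arc g1" "pathstart g1 = x1" "pathfinish g1 = y1" "path_length g1 \<le> ereal L"
    "arc g2" "pathstart g2 = x2" "pathfinish g2 = y2" "path_length g2 \<le> ereal L"
    "path_image g1 \<inter> path_image g2 = {}"
    using assms unfolding disjointly_joinable_def by blast
  have "path_length (reversepath g2) = path_length g2"
    using g(5) by (intro path_length_eq_of_arcs) (auto intro: arc_reversepath)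
  then show ?thesis
    unfolding disjointly_joinable_def using g
    by (intro exI[of _ g1] exI[of _ "reversepath g2"]) (auto intro: arc_reversepath)
qed

lemma disjointly_joinable_segments:
  fixes x1 :: "'a::euclidean_space"
  assumes "x1 \<noteq> y1" "x2 \<noteq> y2" "dist x1 y1 \<le> L" "dist x2 y2 \<le> L"
    "closed_segment x1 y1 \<inter> closed_segment x2 y2 = {}"
  shows "disjointly_joinable L x1 y1 x2 y2"
  unfolding disjointly_joinable_def using assms
  by (intro exI[of _ "linepath x1 y1"] exI[of _ "linepath x2 y2"])
    (auto intro!: arc_linepath order_trans[OF path_length_linepath_le])

text \<open>The second arc is the segment itself; the first is sent through a point \<open>z\<close>
  just beyond \<open>x2\<close> on the same line. Its legs meet the level set
  \<open>n \<bullet> p = n \<bullet> x2\<close> only at \<open>z\<close>, which lies off the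
  segment.\<close>

lemma disjointly_joinable_detour:
  fixes x1 :: "'a::euclidean_space"
  assumes "n \<bullet> x1 < n \<bullet> x2" "n \<bullet> y2 = n \<bullet> x2" "n \<bullet> x2 < n \<bullet> y1" "x2 \<noteq> y2"
    and L: "dist x1 x2 + dist x2 y1 < L" "dist x2 y2 \<le> L"
  shows "disjointly_joinable L x1 y1 x2 y2"
proof -
  \<comment> \<open>The overshoot from \<open>x2\<close> to \<open>z\<close> is half of the
    available slack, because it is paid once on each leg.\<close>
  define d where "d = (L - (dist x1 x2 + dist x2 y1)) / (2 * norm (y2 - x2))"
  have d: "d > 0" and dn: "2 * (d * norm (y2 - x2)) = L - (dist x1 x2 + dist x2 y1)"
    using L assms(4) by (auto simp: d_def)
  define z where "z = x2 - d *\<^sub>R (y2 - x2)"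
  have nz: "n \<bullet> z = n \<bullet> x2" using assms(2) by (simp add: z_def inner_simps)
  have dz: "dist x2 z = d * norm (y2 - x2)" using d by (simp add: z_def dist_norm)
  have len: "dist x1 z + dist z y1 \<le> L"
    using dist_triangle[of x1 z x2] dist_triangle[of z y1 x2] dz dn dist_commute[of z x2] by linarith
  have znot: "z \<notin> closed_segment x2 y2"
  proof
    assume "z \<in> closed_segment x2 y2"
    then obtain u where u: "0 \<le> u" "z = (1 - u) *\<^sub>R x2 + u *\<^sub>R y2" by (auto simp: in_segment)
    then have "(u + d) *\<^sub>R (y2 - x2) = 0" by (simp add: z_def algebra_simps)
    then show False using u d assms(4) by simp
  qed
  have "p = z" if p: "p \<in> path_image (linepath x1 z +++ linepath z y1)" "p \<in> closed_segment x2 y2" for p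
  proof -
    have np: "n \<bullet> p = n \<bullet> x2"
      using p(2) assms(2) by (auto simp: in_segment inner_add_right simp flip: distrib_right)
    consider "p \<in> closed_segment x1 z" | "p \<in> closed_segment z y1"
      using p(1) by (auto simp: path_image_join)
    then show ?thesis
    proof cases
      case 1
      then obtain u where u: "p = (1 - u) *\<^sub>R x1 + u *\<^sub>R z" by (auto simp: in_segment)
      then have "(1 - u) * (n \<bullet> x1) + u * (n \<bullet> x2) = n \<bullet> x2"
        using np nz by (simp add: inner_add_right)
      then have "(1 - u) * (n \<bullet> x2 - n \<bullet> x1) = 0" by (simp add: algebra_simps)
      then show ?thesis using u assms(1) by simp
    next
      case 2
      then obtain u where u: "p = (1 - u) *\<^sub>R z + u *\<^sub>R y1" by (auto simp: in_segment)
      then have "(1 - u) * (n \<bullet> x2) + u * (n \<bullet> y1) = n \<bullet> x2"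
        using np nz by (simp add: inner_add_right)
      then have "u * (n \<bullet> y1 - n \<bullet> x2) = 0" by (simp add: algebra_simps)
      then show ?thesis using u assms(3) by simp
    qed
  qed
  then have "path_image (linepath x1 z +++ linepath z y1) \<inter> path_image (linepath x2 y2) = {}"
    using znot by auto
  moreover have "arc (linepath x1 z +++ linepath z y1)"
    using assms nz by (intro arc_join_linepath[of n]) auto
  moreover have "path_length (linepath x1 z +++ linepath z y1) \<le> ereal L"
    using len by (intro order_trans[OF path_length_join_linepath_le]) simp
  moreover have "path_length (linepath x2 y2) \<le> ereal L"
    using L by (intro order_trans[OF path_length_linepath_le]) simp
  ultimately show ?thesis
    unfolding disjointly_joinable_def using assms(4)
    by (intro exI[of _ "linepath x1 z +++ linepath z y1"] exI[of _ "linepath x2 y2"])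
      (auto intro!: arc_linepath)
qed

text \<open>The midpoint is pushed in the direction \<open>n\<close>, orthogonal to the segment, by
  half of the slack in length. Everything but the endpoints then leaves the level set of
  \<open>n\<close>.\<close>

lemma bent_arc:
  fixes x y :: "'a::euclidean_space"
  assumes "x \<noteq> y" "n \<noteq> 0" "n \<bullet> x = n \<bullet> y" "dist x y < L"
  obtains g where "arc g" "pathstart g = x" "pathfinish g = y" "path_length g \<le> ereal L"
    "\<And>p. p \<in> path_image g \<Longrightarrow> p = x \<or> p = y \<or> n \<bullet> p > n \<bullet> x"
proof -
  define d where "d = (L - dist x y) / (2 * norm n)"
  have d: "d > 0" and dn: "2 * (d * norm n) = L - dist x y"
    using assms by (auto simp: d_def)
  define z where "z = midpoint x y + d *\<^sub>R n"
  have nz: "n \<bullet> z = n \<bullet> x + d * (n \<bullet> n)"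
    using assms(3) by (simp add: z_def midpoint_def inner_simps)
  then have nz: "n \<bullet> z > n \<bullet> x" using d assms(2) by simp
  have dz: "dist (midpoint x y) z = d * norm n" using d by (simp add: z_def dist_norm)
  have len: "dist x z + dist z y \<le> L"
    using dist_triangle[of x z "midpoint x y"] dist_triangle[of z y "midpoint x y"] dz dn
      dist_commute[of z "midpoint x y"] dist_midpoint[of x y] by linarith
  let ?g = "linepath x z +++ linepath z y"
  have pos: "(y - x) \<bullet> (y - x) > 0" using assms(1) by simp
  have perp: "(y - x) \<bullet> n = 0" using assms(3) by (simp add: inner_simps inner_commute)
  \<comment> \<open>Since \<open>n\<close> is orthogonal to \<open>y - x\<close>, the push does not
    affect this functional, which therefore increases strictly along both legs.\<close>
  have "(y - x) \<bullet> z = (y - x) \<bullet> x + (y - x) \<bullet> (y - x) / 2"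
    "(y - x) \<bullet> z = (y - x) \<bullet> y - (y - x) \<bullet> (y - x) / 2"
    using perp by (simp_all add: z_def midpoint_def inner_add_right inner_diff_right field_simps)
  then have arc: "arc ?g"
    using pos by (intro arc_join_linepath[of "y - x"]) linarith+
  show ?thesis
  proof (rule that[OF arc])
    show "path_length ?g \<le> ereal L"
      using len by (intro order_trans[OF path_length_join_linepath_le]) simp
    fix p assume "p \<in> path_image ?g"
    then consider "p \<in> closed_segment x z" | "p \<in> closed_segment z y"
      by (auto simp: path_image_join)
    then show "p = x \<or> p = y \<or> n \<bullet> p > n \<bullet> x"
    proof cases
      case 1
      then obtain u where u: "0 \<le> u" "p = (1 - u) *\<^sub>R x + u *\<^sub>R z" by (auto simp: in_segment)
      have "n \<bullet> p = n \<bullet> x + u * (n \<bullet> z - n \<bullet> x)" unfolding u(2) by (simp add: algebra_simps)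
      then show ?thesis using u nz by (cases "u = 0") auto
    next
      case 2
      then obtain u where u: "u \<le> 1" "p = (1 - u) *\<^sub>R z + u *\<^sub>R y" by (auto simp: in_segment)
      have "n \<bullet> p = n \<bullet> x + (1 - u) * (n \<bullet> z - n \<bullet> x)"
        unfolding u(2) using assms(3) by (simp add: algebra_simps)
      then show ?thesis using u nz by (cases "u = 1") auto
    qed
  qed simp_all
qed

text \<open>The second arc is bent into \<open>n \<bullet> p < n \<bullet> x1\<close> while the
  first stays in \<open>n \<bullet> p \<ge> n \<bullet> x1\<close>. They could meet only at
  endpoints, and these are distinct.\<close>

lemma disjointly_joinable_endpoint_on_line:
  fixes x1 :: "'a::euclidean_space"
  assumes "distinct [x1, y1, x2, y2]" "n \<noteq> 0" "n \<bullet> x2 = n \<bullet> x1" "n \<bullet> y2 = n \<bullet> x1"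
    and "dist x1 y1 < L" "dist x2 y2 < L"
  shows "disjointly_joinable L x1 y1 x2 y2"
proof -
  \<comment> \<open>Replacing \<open>n\<close> by \<open>-n\<close> if necessary, \<open>y1\<close>
    may be taken on the nonnegative side.\<close>
  have *: "disjointly_joinable L x1 y1 x2 y2"
    if n: "n \<noteq> 0" "n \<bullet> x2 = n \<bullet> x1" "n \<bullet> y2 = n \<bullet> x1" "n \<bullet> x1 \<le> n \<bullet> y1" for n
  proof -
    obtain g2 where g2: "arc g2" "pathstart g2 = x2" "pathfinish g2 = y2" "path_length g2 \<le> ereal L"
      "\<And>p. p \<in> path_image g2 \<Longrightarrow> p = x2 \<or> p = y2 \<or> n \<bullet> p < n \<bullet> x1"
      using bent_arc[of x2 y2 "-n" L] n assms by auto
    obtain g1 where g1: "arc g1" "pathstart g1 = x1" "pathfinish g1 = y1" "path_length g1 \<le> ereal L"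
      "\<And>p. p \<in> path_image g1 \<Longrightarrow> p = x1 \<or> p = y1 \<or> n \<bullet> p > n \<bullet> x1"
    \<comment> \<open>If \<open>y1\<close> also lies in the level set, the first arc must be bent as
      well; otherwise its segment leaves the level set at once.\<close>
    proof (cases "n \<bullet> y1 = n \<bullet> x1")
      case True
      then show ?thesis using bent_arc[of x1 y1 n L] n assms that by auto
    next
      case False
      show ?thesis
      proof (rule that[of "linepath x1 y1"])
        show "path_length (linepath x1 y1) \<le> ereal L"
          using assms by (intro order_trans[OF path_length_linepath_le]) simp
        fix p assume "p \<in> path_image (linepath x1 y1)"
        then obtain u where u: "0 \<le> u" "p = (1 - u) *\<^sub>R x1 + u *\<^sub>R y1" by (auto simp: in_segment)
        have "n \<bullet> p = n \<bullet> x1 + u * (n \<bullet> y1 - n \<bullet> x1)"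
          unfolding u(2) by (simp add: algebra_simps)
        then show "p = x1 \<or> p = y1 \<or> n \<bullet> p > n \<bullet> x1" using u n False by (cases "u = 0") auto
      qed (use assms in \<open>auto intro: arc_linepath\<close>)
    qed
    have "path_image g1 \<inter> path_image g2 = {}"
    proof (rule ccontr)
      assume "path_image g1 \<inter> path_image g2 \<noteq> {}"
      then obtain p where "p \<in> path_image g1" "p \<in> path_image g2" by blast
      then show False using g1(5)[of p] g2(5)[of p] n assms(1) by auto
    qed
    then show ?thesis
      unfolding disjointly_joinable_def using g1 g2 by blast
  qed
  show ?thesis using *[of n] *[of "-n"] assms by (cases "n \<bullet> x1 \<le> n \<bullet> y1") auto
qed

section \<open>Crossing segments\<close>

text \<open>Crossing makes \<open>w\<close> a combination of the segment vectors with coefficients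
  of modulus at most 1/2, so \<open>dom\<close> yields
  \<open>w \<bullet> w \<le> w \<bullet> (y2 - x2)\<close>. The parallelogram law then bounds the
  sum of the squared distances by 1.\<close>

lemma detour_around_start_le_sqrt2:
  fixes x1 y1 x2 y2 :: "'a::real_inner"
  defines "w \<equiv> midpoint x2 y2 - midpoint x1 y1"
  assumes "dist x1 y1 \<le> 1" "dist x2 y2 \<le> 1" "p \<in> closed_segment x1 y1" "p \<in> closed_segment x2 y2"
    and dom: "\<bar>w \<bullet> (y1 - x1)\<bar> \<le> w \<bullet> (y2 - x2)"
  shows "dist x1 x2 + dist x2 y1 \<le> sqrt 2"
proof -
  define D1 D2 where "D1 = y1 - x1" and "D2 = y2 - x2"
  obtain u where u: "0 \<le> u" "u \<le> 1" "p = (1 - u) *\<^sub>R x1 + u *\<^sub>R y1"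
    using assms by (auto simp: in_segment)
  obtain v where v: "0 \<le> v" "v \<le> 1" "p = (1 - v) *\<^sub>R x2 + v *\<^sub>R y2"
    using assms by (auto simp: in_segment)
  have p1: "p = midpoint x1 y1 + (u - 1/2) *\<^sub>R D1"
    unfolding u(3) by (simp add: midpoint_def D1_def algebra_simps flip: scaleR_add_left)
  have p2: "p = midpoint x2 y2 + (v - 1/2) *\<^sub>R D2"
    unfolding v(3) by (simp add: midpoint_def D2_def algebra_simps flip: scaleR_add_left)
  have weq: "w = (u - 1/2) *\<^sub>R D1 - (v - 1/2) *\<^sub>R D2"
    using p1 p2 unfolding w_def by (metis add_diff_cancel_left' add_diff_eq diff_diff_eq2 diff_add_eq)
  \<comment> \<open>Only one factor is expanded, so that the products controlled by
    \<open>dom\<close> appear.\<close>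
  have "w \<bullet> w = (u - 1/2) * (w \<bullet> D1) - (v - 1/2) * (w \<bullet> D2)"
    by (subst (2) weq) (simp add: inner_simps)
  moreover have "(u - 1/2) * (w \<bullet> D1) \<le> 1/2 * (w \<bullet> D2)"
  proof -
    have "(u - 1/2) * (w \<bullet> D1) \<le> \<bar>u - 1/2\<bar> * \<bar>w \<bullet> D1\<bar>" by (metis abs_ge_self abs_mult)
    also have "\<dots> \<le> 1/2 * (w \<bullet> D2)"
      using u dom by (intro mult_mono) (auto simp: D1_def D2_def abs_if)
    finally show ?thesis .
  qed
  moreover have "- (v - 1/2) * (w \<bullet> D2) \<le> 1/2 * (w \<bullet> D2)"
    using v dom by (intro mult_right_mono) (auto simp: D2_def)
  ultimately have ww: "w \<bullet> w \<le> w \<bullet> D2" by (simp add: left_diff_distrib)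
  \<comment> \<open>These are the vectors from the midpoint of the first segment to
    \<open>x2\<close> and to \<open>y1\<close>.\<close>
  define a b where "a = w - (1/2) *\<^sub>R D2" and "b = (1/2) *\<^sub>R D1"
  have ab: "x2 - x1 = b + a" "y1 - x2 = b - a"
    unfolding a_def b_def w_def D1_def D2_def midpoint_def
    by (simp_all add: algebra_simps flip: scaleR_add_left)
  have "(dist x1 x2)\<^sup>2 + (dist x2 y1)\<^sup>2 = (b + a) \<bullet> (b + a) + (b - a) \<bullet> (b - a)"
    by (simp add: dist_norm norm_minus_commute flip: power2_norm_eq_inner ab)
  also have "\<dots> = 2 * (a \<bullet> a) + 2 * (b \<bullet> b)"
    by (simp add: inner_add_left inner_add_right inner_diff_left inner_diff_right)
  also have "a \<bullet> a = w \<bullet> w - w \<bullet> D2 + (D2 \<bullet> D2) / 4"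
    by (simp add: a_def inner_diff_left inner_diff_right inner_commute[of D2 w] diff_divide_distrib)
  also have "b \<bullet> b = (D1 \<bullet> D1) / 4" by (simp add: b_def)
  also have "2 * (w \<bullet> w - w \<bullet> D2 + (D2 \<bullet> D2) / 4) + 2 * ((D1 \<bullet> D1) / 4)
      \<le> (D1 \<bullet> D1 + D2 \<bullet> D2) / 2"
    using ww by simp
  also have "\<dots> \<le> 1"
  proof -
    have "D1 \<bullet> D1 \<le> 1" "D2 \<bullet> D2 \<le> 1"
      using assms by (simp_all add: D1_def D2_def dist_norm norm_minus_commute power_le_one
          flip: power2_norm_eq_inner)
    then show ?thesis by simp
  qed
  finally have "(dist x1 x2 + dist x2 y1)\<^sup>2 \<le> 2"
    using sum_squares_bound[of "dist x1 x2" "dist x2 y1"] by (simp add: power2_sum)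
  then show ?thesis by (rule real_le_rsqrt)
qed

text \<open>The largest of the four numbers \<open>w \<bullet> (y1 - x1)\<close>,
  \<open>w \<bullet> (y2 - x2)\<close> and their negatives selects the endpoint. Reversing a segment
  negates its product; exchanging the segments negates \<open>w\<close>.\<close>

lemma detour_le_sqrt2:
  fixes x1 :: "'a::real_inner"
  assumes "dist x1 y1 \<le> 1" "dist x2 y2 \<le> 1" "p \<in> closed_segment x1 y1" "p \<in> closed_segment x2 y2"
  shows "dist x1 x2 + dist x2 y1 \<le> sqrt 2 \<or> dist x1 y2 + dist y2 y1 \<le> sqrt 2 \<or>
    dist x2 x1 + dist x1 y2 \<le> sqrt 2 \<or> dist x2 y1 + dist y1 y2 \<le> sqrt 2"
proof -
  define w where "w = midpoint x2 y2 - midpoint x1 y1"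
  have neg: "midpoint x1 y1 - midpoint x2 y2 = - w" by (simp add: w_def)
  have flip: "w \<bullet> (x1 - y1) = - (w \<bullet> (y1 - x1))" "w \<bullet> (x2 - y2) = - (w \<bullet> (y2 - x2))"
    by (simp_all add: inner_simps)
  consider "\<bar>w \<bullet> (y1 - x1)\<bar> \<le> w \<bullet> (y2 - x2)" | "\<bar>w \<bullet> (y1 - x1)\<bar> \<le> - (w \<bullet> (y2 - x2))"
    | "\<bar>w \<bullet> (y2 - x2)\<bar> \<le> w \<bullet> (y1 - x1)" | "\<bar>w \<bullet> (y2 - x2)\<bar> \<le> - (w \<bullet> (y1 - x1))"
    by linarith
  then show ?thesis
  proof cases
    case 1
    then show ?thesis using detour_around_start_le_sqrt2[of x1 y1 x2 y2 p] assms by (simp add: w_def)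
  next
    case 2
    then show ?thesis
      using detour_around_start_le_sqrt2[of x1 y1 y2 x2 p] assms flip
      by (simp add: midpoint_sym[of y2 x2] closed_segment_commute dist_commute flip: w_def)
  next
    case 3
    then show ?thesis
      using detour_around_start_le_sqrt2[of x2 y2 y1 x1 p] assms flip
      by (simp add: midpoint_sym[of y1 x1] neg closed_segment_commute dist_commute)
  next
    case 4
    then show ?thesis
      using detour_around_start_le_sqrt2[of x2 y2 x1 y1 p] assms flip
      by (simp add: neg closed_segment_commute dist_commute)
  qed
qed

text \<open>The common point \<open>p\<close> lies in the level set of \<open>n\<close> through
  \<open>x2\<close>, whereas \<open>x1\<close> and \<open>y1\<close> do not. They are therefore
  strictly on opposite sides, as the detour requires up to the sign of \<open>n\<close>.\<close>

lemma disjointly_joinable_crossing: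
  fixes x1 :: "'a::euclidean_space"
  assumes "p \<in> closed_segment x1 y1" "p \<in> closed_segment x2 y2"
    and n: "n \<bullet> y2 = n \<bullet> x2" "n \<bullet> x1 \<noteq> n \<bullet> x2" "n \<bullet> y1 \<noteq> n \<bullet> x2" and "x2 \<noteq> y2"
    and L: "dist x1 x2 + dist x2 y1 < L" "dist x2 y2 \<le> L"
  shows "disjointly_joinable L x1 y1 x2 y2"
proof -
  have np: "n \<bullet> p = n \<bullet> x2"
    using assms(2) n(1) by (auto simp: in_segment inner_add_right simp flip: distrib_right)
  obtain u where u: "0 \<le> u" "u \<le> 1" "p = (1 - u) *\<^sub>R x1 + u *\<^sub>R y1"
    using assms(1) by (auto simp: in_segment)
  have np': "(1 - u) * (n \<bullet> x1) + u * (n \<bullet> y1) = n \<bullet> x2"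
    using np unfolding u(3) by (simp add: inner_simps)
  consider "n \<bullet> x1 < n \<bullet> x2" "n \<bullet> x2 < n \<bullet> y1" | "n \<bullet> y1 < n \<bullet> x2" "n \<bullet> x2 < n \<bullet> x1"
    using convex_bound_lt[of "n \<bullet> x1" "n \<bullet> x2" "n \<bullet> y1" "1 - u" u]
      convex_bound_lt[of "- (n \<bullet> x1)" "- (n \<bullet> x2)" "- (n \<bullet> y1)" "1 - u" u] np' n u
    by (auto simp: not_less le_less neq_iff)
  then show ?thesis
    using disjointly_joinable_detour[of n x1 x2 y2 y1 L] disjointly_joinable_detour[of "-n" x1 x2 y2 y1 L]
      assms by cases auto
qed

section \<open>The upper bound in the plane\<close>

lemma normal_vector_plane:
  fixes x y :: "real^2"
  assumes "x \<noteq> y"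
  obtains n where "n \<noteq> 0" "n \<bullet> y = n \<bullet> x"
proof
  \<comment> \<open>A quarter turn of \<open>x - y\<close>.\<close>
  let ?n = "vector [x$2 - y$2, y$1 - x$1] :: real^2"
  show "?n \<noteq> 0" using assms by (auto simp: vec_eq_iff forall_2)
  show "?n \<bullet> y = ?n \<bullet> x" by (simp add: inner_vec_def sum_2 algebra_simps)
qed

text \<open>Either an endpoint lies on the line through the other pair and the arcs are bent, or the
  segments are disjoint, or they cross with all endpoints off the other line and a detour
  works.\<close>

lemma disjointly_joinable_plane:
  fixes x1 :: "real^2"
  assumes "distinct [x1, y1, x2, y2]" "dist x1 y1 \<le> 1" "dist x2 y2 \<le> 1" "L > sqrt 2"
  shows "disjointly_joinable L x1 y1 x2 y2"
proof -
  have "sqrt 2 > 1" by simp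
  then have L: "dist x1 y1 < L" "dist x2 y2 < L" using assms by linarith+
  obtain n1 where n1: "n1 \<noteq> 0" "n1 \<bullet> y1 = n1 \<bullet> x1"
    using normal_vector_plane assms(1) by (metis distinct_length_2_or_more)
  obtain n2 where n2: "n2 \<noteq> 0" "n2 \<bullet> y2 = n2 \<bullet> x2"
    using normal_vector_plane assms(1) by (metis distinct_length_2_or_more)
  note swap = disjointly_joinable_swap[of L x1 y1 x2 y2]
  note flip2 = disjointly_joinable_flip[of L x1 y1 y2 x2]
  have flip1: "disjointly_joinable L y1 x1 x2 y2 \<Longrightarrow> disjointly_joinable L x1 y1 x2 y2"
    using disjointly_joinable_flip[of L x2 y2 y1 x1] disjointly_joinable_swap by blast
  have flip3: "disjointly_joinable L x2 y2 y1 x1 \<Longrightarrow> disjointly_joinable L x1 y1 x2 y2"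
    using flip1 disjointly_joinable_swap by blast
  show ?thesis
  proof (cases "n2 \<bullet> x1 = n2 \<bullet> x2 \<or> n2 \<bullet> y1 = n2 \<bullet> x2 \<or> n1 \<bullet> x2 = n1 \<bullet> x1 \<or> n1 \<bullet> y2 = n1 \<bullet> x1")
    case True
    then show ?thesis
    proof (elim disjE)
      assume "n2 \<bullet> x1 = n2 \<bullet> x2"
      then show ?thesis using disjointly_joinable_endpoint_on_line[of x1 y1 x2 y2 n2 L] n2 L assms(1) by auto
    next
      assume "n2 \<bullet> y1 = n2 \<bullet> x2"
      then show ?thesis
        using disjointly_joinable_endpoint_on_line[of y1 x1 x2 y2 n2 L] n2 L assms(1) flip1
        by (auto simp: dist_commute)
    next
      assume "n1 \<bullet> x2 = n1 \<bullet> x1"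
      then show ?thesis
        using disjointly_joinable_endpoint_on_line[of x2 y2 x1 y1 n1 L] n1 L assms(1) swap by auto
    next
      assume "n1 \<bullet> y2 = n1 \<bullet> x1"
      then show ?thesis
        using disjointly_joinable_endpoint_on_line[of y2 x2 x1 y1 n1 L] n1 L assms(1) flip2
          disjointly_joinable_swap[of L y2 x2 x1 y1] by (auto simp: dist_commute)
    qed
  next
    case off: False
    show ?thesis
    proof (cases "closed_segment x1 y1 \<inter> closed_segment x2 y2 = {}")
      case True
      then show ?thesis using L assms(1) by (intro disjointly_joinable_segments) auto
    next
      case False
      then obtain p where p: "p \<in> closed_segment x1 y1" "p \<in> closed_segment x2 y2" by blast
      then have p': "p \<in> closed_segment y1 x1" "p \<in> closed_segment y2 x2"
        by (simp_all add: closed_segment_commute)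
      consider "dist x1 x2 + dist x2 y1 \<le> sqrt 2" | "dist x1 y2 + dist y2 y1 \<le> sqrt 2"
        | "dist x2 x1 + dist x1 y2 \<le> sqrt 2" | "dist x2 y1 + dist y1 y2 \<le> sqrt 2"
        using detour_le_sqrt2[OF assms(2,3) p] by blast
      then show ?thesis
      proof cases
        case 1
        then show ?thesis
          using disjointly_joinable_crossing[OF p(1) p(2), of n2 L] n2 off L assms by auto
      next
        case 2
        then show ?thesis
          using disjointly_joinable_crossing[OF p(1) p'(2), of n2 L] n2 off L assms flip2
          by (auto simp: dist_commute)
      next
        case 3
        then show ?thesis
          using disjointly_joinable_crossing[OF p(2) p(1), of n1 L] n1 off L assms swap by auto
      next
        case 4
        then show ?thesis
          using disjointly_joinable_crossing[OF p(2) p'(1), of n1 L] n1 off L assms flip3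
          by (auto simp: dist_commute)
      qed
    qed
  qed
qed

lemma lam_le_sqrt2:
  assumes "P \<in> admissible_pairs"
  shows "lam P \<le> ereal (sqrt 2)"
proof (rule ereal_le_epsilon2)
  fix e :: real assume "e > 0"
  obtain x1 y1 x2 y2 where P: "P = ((x1, y1), (x2, y2))" by (metis surj_pair)
  have "disjointly_joinable (sqrt 2 + e) x1 y1 x2 y2"
    using assms \<open>e > 0\<close> by (intro disjointly_joinable_plane) (auto simp: P admissible_pairs_def dist_norm)
  then obtain g1 g2 where g: "arc g1" "pathstart g1 = x1" "pathfinish g1 = y1"
    "path_length g1 \<le> ereal (sqrt 2 + e)" "arc g2" "pathstart g2 = x2" "pathfinish g2 = y2"
    "path_length g2 \<le> ereal (sqrt 2 + e)" "path_image g1 \<inter> path_image g2 = {}"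
    unfolding disjointly_joinable_def by blast
  have "rectifiable g1" "rectifiable g2"
    using g(4,8) by (auto simp: rectifiable_def intro: le_less_trans)
  then have "lam P \<le> max (path_length g1) (path_length g2)"
    unfolding lam_def P using g by (auto intro!: INF_lower2[of "(g1, g2)"] simp: rectifiable_arcs_def)
  also have "\<dots> \<le> ereal (sqrt 2) + ereal e" using g(4,8) by simp
  finally show "lam P \<le> ereal (sqrt 2) + ereal e" .
qed

section \<open>The diagonals of a square\<close>

text \<open>Reflecting the second leg of the detour in the first axis turns the bound into the triangle inequality.\<close>

lemma detour_height:
  fixes a b :: real
  assumes "sqrt ((a + 1/2)\<^sup>2 + b\<^sup>2) + sqrt ((a - 1/2)\<^sup>2 + b\<^sup>2) < sqrt 2"
  shows "\<bar>b\<bar> < 1/2" "\<bar>a\<bar> \<le> 2"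
proof -
  have "sqrt (((a + 1/2) + (1/2 - a))\<^sup>2 + (b + b)\<^sup>2) \<le> sqrt ((a + 1/2)\<^sup>2 + b\<^sup>2) + sqrt ((1/2 - a)\<^sup>2 + b\<^sup>2)"
    by (rule real_sqrt_sum_squares_triangle_ineq)
  also have "\<dots> < sqrt 2" using assms by (simp add: power2_commute)
  \<comment> \<open>The horizontal parts of the two legs add up to 1, so the left side of the chain
    is the square root of \<open>1 + (2 * b)\<^sup>2\<close>.\<close>
  finally have "(2 * b)\<^sup>2 < 1\<^sup>2" by simp
  then show "\<bar>b\<bar> < 1/2" using abs_le_square_iff[of 1 "2 * b"] by fastforce
  have "\<bar>a + 1/2\<bar> \<le> sqrt ((a + 1/2)\<^sup>2 + b\<^sup>2)" "0 \<le> sqrt ((a - 1/2)\<^sup>2 + b\<^sup>2)"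
    by (auto intro!: real_le_rsqrt)
  \<comment> \<open>A crude estimate suffices: it bounds \<open>a + 1/2\<close> by 3/2 in modulus,
    and the bound 2 for \<open>a\<close> only serves to fit the arc into a box.\<close>
  moreover have "sqrt 2 < (3/2 :: real)" by (rule real_less_lsqrt) (auto simp: power2_eq_square)
  ultimately show "\<bar>a\<bar> \<le> 2" using assms by linarith
qed

text \<open>\<open>fashoda\<close> needs paths that join opposite sides of a box, so both arcs are
  prolonged along the axes. The strict strip bounds keep each arc off the prolongations of the
  other.\<close>

lemma square_diagonals_meet:
  fixes g1 g2 :: "real \<Rightarrow> real^2"
  assumes "path g1" "pathstart g1 = vector [-1/2, 0]" "pathfinish g1 = vector [1/2, 0]"
    and "path g2" "pathstart g2 = vector [0, -1/2]" "pathfinish g2 = vector [0, 1/2]"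
    and "path_length g1 < ereal (sqrt 2)" "path_length g2 < ereal (sqrt 2)"
  shows "path_image g1 \<inter> path_image g2 \<noteq> {}"
proof -
  have dist2: "dist p q = sqrt ((p$1 - q$1)\<^sup>2 + (p$2 - q$2)\<^sup>2)" for p q :: "real^2"
    by (simp add: dist_norm norm_vec_def L2_set_def sum_2)
  have g1: "\<bar>p$2\<bar> < 1/2" "\<bar>p$1\<bar> \<le> 2" if "p \<in> path_image g1" for p
  proof -
    have "dist (pathstart g1) p + dist p (pathfinish g1) < sqrt 2"
      using path_length_ge_dist_via[OF that] assms(7) by (metis less_ereal.simps(1) order_le_less_trans)
    then have "sqrt ((p$1 + 1/2)\<^sup>2 + (p$2)\<^sup>2) + sqrt ((p$1 - 1/2)\<^sup>2 + (p$2)\<^sup>2) < sqrt 2"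
      unfolding dist_commute[of "pathstart g1" p] using assms by (simp add: dist2)
    from detour_height[OF this] show "\<bar>p$2\<bar> < 1/2" "\<bar>p$1\<bar> \<le> 2" .
  qed
  have g2: "\<bar>p$1\<bar> < 1/2" "\<bar>p$2\<bar> \<le> 2" if "p \<in> path_image g2" for p
  proof -
    have "dist (pathstart g2) p + dist p (pathfinish g2) < sqrt 2"
      using path_length_ge_dist_via[OF that] assms(8) by (metis less_ereal.simps(1) order_le_less_trans)
    \<comment> \<open>The coordinates exchange roles, so \<open>detour_height\<close> applies to the
      vertical diagonal too.\<close>
    then have "sqrt ((p$2 + 1/2)\<^sup>2 + (p$1)\<^sup>2) + sqrt ((p$2 - 1/2)\<^sup>2 + (p$1)\<^sup>2) < sqrt 2"
      unfolding dist_commute[of "pathstart g2" p] using assms by (simp add: dist2 add.commute)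
    from detour_height[OF this] show "\<bar>p$1\<bar> < 1/2" "\<bar>p$2\<bar> \<le> 2" .
  qed
  let ?l = "linepath (vector [-2, 0]) (vector [-1/2, 0]) :: real \<Rightarrow> real^2"
  let ?r = "linepath (vector [1/2, 0]) (vector [2, 0]) :: real \<Rightarrow> real^2"
  let ?d = "linepath (vector [0, -2]) (vector [0, -1/2]) :: real \<Rightarrow> real^2"
  let ?u = "linepath (vector [0, 1/2]) (vector [0, 2]) :: real \<Rightarrow> real^2"
  let ?f = "?l +++ g1 +++ ?r" and ?g = "?d +++ g2 +++ ?u"
  have l: "p$2 = 0 \<and> p$1 \<le> -1/2 \<and> -2 \<le> p$1" if "p \<in> path_image ?l" for p
    using that by (auto simp: in_segment; simp add: field_simps)
  have r: "p$2 = 0 \<and> 1/2 \<le> p$1 \<and> p$1 \<le> 2" if "p \<in> path_image ?r" for p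
    using that by (auto simp: in_segment; simp add: field_simps)
  have d: "p$1 = 0 \<and> p$2 \<le> -1/2 \<and> -2 \<le> p$2" if "p \<in> path_image ?d" for p
    using that by (auto simp: in_segment; simp add: field_simps)
  have u: "p$1 = 0 \<and> 1/2 \<le> p$2 \<and> p$2 \<le> 2" if "p \<in> path_image ?u" for p
    using that by (auto simp: in_segment; simp add: field_simps)
  have imf: "path_image ?f = path_image ?l \<union> path_image g1 \<union> path_image ?r"
    using assms by (simp add: path_image_join Un_assoc)
  have img: "path_image ?g = path_image ?d \<union> path_image g2 \<union> path_image ?u"
    using assms by (simp add: path_image_join Un_assoc)
  have boxf: "path_image ?f \<subseteq> cbox (vector [-2, -2]) (vector [2, 2])"
  proof
    fix p assume "p \<in> path_image ?f"
    then have "\<bar>p$1\<bar> \<le> 2 \<and> \<bar>p$2\<bar> \<le> 2"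
      using l[of p] r[of p] g1[of p] unfolding imf Un_iff by linarith
    then show "p \<in> cbox (vector [-2, -2]) (vector [2, 2])" by (auto simp: mem_box_cart forall_2)
  qed
  have boxg: "path_image ?g \<subseteq> cbox (vector [-2, -2]) (vector [2, 2])"
  proof
    fix p assume "p \<in> path_image ?g"
    then have "\<bar>p$1\<bar> \<le> 2 \<and> \<bar>p$2\<bar> \<le> 2"
      using d[of p] u[of p] g2[of p] unfolding img Un_iff by linarith
    then show "p \<in> cbox (vector [-2, -2]) (vector [2, 2])" by (auto simp: mem_box_cart forall_2)
  qed
  obtain z where z: "z \<in> path_image ?f" "z \<in> path_image ?g"
    by (rule fashoda[OF _ _ boxf boxg]) (use assms in auto)
  \<comment> \<open>A crossing on a horizontal prolongation would lie outside the strip of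
    \<open>g2\<close> and off the second axis, where the other path has no points; the vertical case
    is symmetric.\<close>
  have "z \<in> path_image g1 \<or> z$2 = 0 \<and> 1/2 \<le> \<bar>z$1\<bar>"
    using z(1) l[of z] r[of z] unfolding imf Un_iff by linarith
  moreover have "z \<in> path_image g2 \<or> z$1 = 0 \<and> 1/2 \<le> \<bar>z$2\<bar>"
    using z(2) d[of z] u[of z] unfolding img Un_iff by linarith
  ultimately have "z \<in> path_image g1 \<and> z \<in> path_image g2"
    using g1(1)[of z] g2(1)[of z] by linarith
  then show ?thesis by blast
qed

lemma square_diagonals_lam:
  "ereal (sqrt 2) \<le> lam ((vector [-1/2, 0], vector [1/2, 0]), (vector [0, -1/2], vector [0, 1/2]))"
  unfolding lam_def prod.case
proof (rule INF_greatest, safe)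
  fix g1 g2 :: "real \<Rightarrow> real^2"
  assume g: "g1 \<in> rectifiable_arcs (vector [-1/2, 0]) (vector [1/2, 0])"
    "g2 \<in> rectifiable_arcs (vector [0, -1/2]) (vector [0, 1/2])"
    "path_image g1 \<inter> path_image g2 = {}"
  show "ereal (sqrt 2) \<le> max (path_length g1) (path_length g2)"
  proof (rule ccontr)
    assume "\<not> ?thesis"
    then have "path_length g1 < ereal (sqrt 2)" "path_length g2 < ereal (sqrt 2)"
      by (simp_all add: not_le)
    then have "path_image g1 \<inter> path_image g2 \<noteq> {}"
      using g(1,2) by (intro square_diagonals_meet) (auto simp: rectifiable_arcs_def arc_imp_path)
    then show False using g(3) by blast
  qed
qed

theorem theorem1:
  shows "C2 = ereal (sqrt 2)"
proof (rule antisym)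
  show "C2 \<le> ereal (sqrt 2)"
    unfolding C2_def by (intro SUP_least lam_le_sqrt2)
  \<comment> \<open>The diagonals have length exactly 1, the largest distance allowed.\<close>
  have "((vector [-1/2, 0], vector [1/2, 0]), (vector [0, -1/2], vector [0, 1/2])) \<in> admissible_pairs"
    by (simp add: admissible_pairs_def vec_eq_iff forall_2 norm_vec_def L2_set_def sum_2)
  then show "ereal (sqrt 2) \<le> C2"
    unfolding C2_def using square_diagonals_lam by (rule SUP_upper2)
qed

end
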